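(* Let $\mathbb{F}$ be an infinite field and let $A$ be a standard graded Artinian Gorenstein $\mathbb{F}$-algebra of socle degree $j$ with Hilbert function $H(A)=(h_0,h_1,\ldots,h_j)$, $h_i=\dim_{\mathbb F}A_i$, satisfying $h_1=3$. Then the sequence $H(A)$ is log-concave, that is, $h_{i-1}\cdot h_{i+1}\le h_i^2$ for every integer $i$ with $1\le i\le j-1$.
   Context: The socle of an Artinian graded algebra $A$ with maximal homogeneous ideal $\mathfrak m_A$ is $(0:\mathfrak m_A)$; the socle degree is the highest degree of a socle element. When $A$ is Artinian Gorenstein, the socle degree is the highest degree $j$ with $A_j\neq 0$. *)

theory Defs
  imports Complex_Main
begin

text \<open>An $\mathbb N$-graded commutative algebra over a field: the ground field acts on the ring
  \<^typ>\<open>'a\<close> through \<open>scale\<close>, and \<open>A i\<close> is the homogeneous component of degree \<open>i\<close>.\<close>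

locale graded_algebra = vector_space scale
  for scale :: "'k::field \<Rightarrow> 'a::comm_ring_1 \<Rightarrow> 'a" +
  fixes A :: "nat \<Rightarrow> 'a set"
  assumes scale_mult: "scale c x * y = scale c (x * y)"
    and subspace_component: "subspace (A i)"
    and one_component: "1 \<in> A 0"
    and mult_component: "x \<in> A i \<Longrightarrow> y \<in> A k \<Longrightarrow> x * y \<in> A (i + k)"
    and direct_sum:
      "\<exists>!c. (\<forall>i. c i \<in> A i) \<and> finite {i. c i \<noteq> 0} \<and> x = (\<Sum>i | c i \<noteq> 0. c i)"
begin

definition hilbert_function :: "nat \<Rightarrow> nat" where
  "hilbert_function i = dim (A i)"

text \<open>The ideal $\bigoplus_{i \ge 1} A_i$; it is the unique maximal homogeneous ideal once
  $A_0$ is the ground field.\<close>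

definition maximal_homogeneous_ideal :: "'a set" where
  "maximal_homogeneous_ideal = span (\<Union>i\<in>{1..}. A i)"

definition socle :: "'a set" where
  "socle = {x. \<forall>y\<in>maximal_homogeneous_ideal. y * x = 0}"

text \<open>The element \<open>0\<close> is homogeneous of all degrees, so only nonzero socle elements count.\<close>

definition socle_degree :: nat where
  "socle_degree = (GREATEST i. \<exists>x\<in>socle \<inter> A i. x \<noteq> 0)"

end

locale standard_graded_algebra = graded_algebra +
  assumes component_0: "A 0 = range (\<lambda>c. scale c 1)"
    and finite_dimensional_component_1: "\<exists>B. finite B \<and> span B = A 1"
    and generated_in_degree_1:
      "\<lbrakk>subspace S; 1 \<in> S; \<And>x y. x \<in> S \<Longrightarrow> y \<in> S \<Longrightarrow> x * y \<in> S; A 1 \<subseteq> S\<rbrakk> \<Longrightarrow> S = UNIV"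

text \<open>The ideals of a commutative ring are its submodules as a module over itself, which is what
  \<open>module.subspace (*)\<close> expresses. Artinian is the descending chain condition on these
  ideals, homogeneous or not.\<close>

locale artinian_standard_graded_algebra = standard_graded_algebra scale A
  for scale :: "'k::field \<Rightarrow> 'a::comm_ring_1 \<Rightarrow> 'a" and A +
  assumes descending_chain_condition:
    "\<lbrakk>\<And>n. module.subspace (*) (I n :: 'a set); \<And>n. I (Suc n) \<subseteq> I n\<rbrakk>
      \<Longrightarrow> \<exists>n. \<forall>m\<ge>n. I m = I n"

text \<open>An Artinian graded algebra with residue field the ground field is Gorenstein when its
  socle is one-dimensional. (\<open>dim\<close> is \<open>0\<close> for infinite-dimensional spaces, so the
  value \<open>1\<close> does mean a one-element basis.)\<close>

locale artinian_gorenstein_algebra = artinian_standard_graded_algebra +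
  assumes dim_socle: "dim socle = 1"

end

theory Submission
  imports Defs "HOL-Computational_Algebra.Polynomial"
begin

text \<open>Let \<open>e\<close> be the socle degree and let \<open>d\<close> be the least degree with
  \<open>A\<^bsub>d+1\<^esub> = l A\<^sub>d + m A\<^sub>d\<close> for some linear forms \<open>l\<close>, \<open>m\<close>. If the monomials of some
  degree in three generators \<open>x\<close>, \<open>y\<close>, \<open>z\<close> are linearly dependent, the relation does not vanish at
  some point \<open>(a, b, 1)\<close>, because the field is infinite, and then \<open>l = x - a z\<close> and \<open>m = y - b z\<close>
  generate that degree. So \<open>h\<^sub>i\<close> is a triangular number for \<open>i \<le> d\<close>, which settles these \<open>i\<close>
  and, by the symmetry of \<open>h\<close>, the \<open>i\<close> with \<open>e - i \<le> d\<close>.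

  For the other \<open>i\<close> the Hilbert function is even concave. The ranks \<open>r\<^sub>i = dim (l A\<^sub>i)\<close> satisfy
  \<open>r\<^sub>i = r\<^bsub>e-1-i\<^esub>\<close> by Gorenstein duality, and multiplication by \<open>m\<close> maps \<open>A / l A\<close> onto itself in
  degrees above \<open>d\<close>, so \<open>h\<^bsub>i+1\<^esub> - r\<^sub>i \<le> h\<^sub>i - r\<^bsub>i-1\<^esub>\<close> for \<open>i \<ge> d\<close>. Adding the inequalities for \<open>i\<close>
  and for \<open>e - i\<close> cancels the ranks and leaves \<open>h\<^bsub>i-1\<^esub> + h\<^bsub>i+1\<^esub> \<le> 2 h\<^sub>i\<close>.\<close>

section \<open>Finite bases and independent families\<close>

context vector_space
begin

text \<open>The finite set \<open>W\<close> bounds the size of every independent subset of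
  \<open>V\<close>, so the basis is finite and \<open>card B\<close> is a true count.\<close>

lemma dim_basis:
  assumes "V \<subseteq> span W" "finite W"
  obtains B where "B \<subseteq> V" "finite B" "independent B" "V \<subseteq> span B" "card B = dim V"
proof -
  obtain B where B: "B \<subseteq> V" "independent B" "V \<subseteq> span B" "card B = dim V"
    using basis_exists by blast
  have "finite B"
    using independent_span_bound[of W B] assms B by auto
  then show ?thesis using that B by blast
qed

text \<open>The added vectors \<open>C\<close> represent a basis of \<open>span V\<close> modulo
  \<open>span U\<close>, so quotient dimensions can be handled without quotient spaces.\<close>

lemma dim_basis_extend:
  assumes "V \<subseteq> span W" "finite W" "U \<subseteq> V"
  obtains B C where "B \<subseteq> U" "finite B" "U \<subseteq> span B" "card B = dim U"
    "C \<subseteq> V" "finite C" "V \<subseteq> span (B \<union> C)" "dim V = dim U + card C"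
proof -
  obtain B where B: "B \<subseteq> U" "finite B" "independent B" "U \<subseteq> span B" "card B = dim U"
    using dim_basis[of U W] assms by blast
  obtain D where D: "B \<subseteq> D" "D \<subseteq> V" "independent D" "V \<subseteq> span D"
    by (rule maximal_independent_subset_extend[of B V]) (use B assms(3) in auto)
  have fD: "finite D"
    using independent_span_bound[of W D] assms D by auto
  have "card D = dim V"
    using basis_card_eq_dim D by blast
  moreover have "card D = card B + card (D - B)"
    using D fD by (metis card_Diff_subset card_mono finite_subset le_add_diff_inverse)
  moreover have "V \<subseteq> span (B \<union> (D - B))" using D by (simp add: Un_absorb1)
  ultimately show ?thesis
    using B D fD by (intro that[of B "D - B"]) auto
qed

text \<open>A repeated vector would itself give a nontrivial relation, so the image is as large as
  the index set.\<close>

lemma independent_family: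
  assumes "finite T"
    and "\<And>u. (\<Sum>t\<in>T. scale (u t) (f t)) = 0 \<Longrightarrow> \<forall>t\<in>T. u t = 0"
  shows "inj_on f T" "independent (f ` T)"
proof -
  show inj: "inj_on f T"
  proof (rule inj_onI, rule ccontr)
    fix s t assume st: "s \<in> T" "t \<in> T" "f s = f t" "s \<noteq> t"
    define u where "u = (\<lambda>r. if r = s then 1 else if r = t then - 1 else (0::'a))"
    have "(\<Sum>r\<in>T. scale (u r) (f r)) = (\<Sum>r\<in>{s,t}. scale (u r) (f r))"
      by (rule sum.mono_neutral_right) (use st assms(1) in \<open>auto simp: u_def\<close>)
    also have "\<dots> = 0" using st by (simp add: u_def)
    finally have "u s = 0" using assms(2) st by blast
    then show False by (simp add: u_def)
  qed
  show "independent (f ` T)"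
  proof
    assume "dependent (f ` T)"
    then obtain u where u: "\<exists>v\<in>f ` T. u v \<noteq> 0" "(\<Sum>v\<in>f ` T. scale (u v) v) = 0"
      using dependent_finite[of "f ` T"] assms(1) by auto
    then have "(\<Sum>t\<in>T. scale (u (f t)) (f t)) = 0"
      by (simp add: sum.reindex[OF inj] o_def)
    then have "\<forall>t\<in>T. u (f t) = 0" using assms(2)[of "\<lambda>t. u (f t)"] by blast
    with u show False by blast
  qed
qed

end

section \<open>Nonvanishing of polynomials over an infinite field; counting monomials\<close>

lemma poly_sum_nonzero_point:
  fixes u :: "nat \<Rightarrow> 'k::field"
  assumes "infinite (UNIV :: 'k set)" "q \<le> n" "u q \<noteq> 0"
  obtains b where "(\<Sum>i\<le>n. u i * b ^ i) \<noteq> 0"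
proof -
  define p where "p = (\<Sum>i\<le>n. monom (u i) i)"
  have "coeff p q = u q"
    using assms(2) by (simp add: p_def coeff_sum if_distrib cong: if_cong)
  then have "p \<noteq> 0" using assms(3) by auto
  then have "finite {b. poly p b = 0}" by (rule poly_roots_finite)
  then obtain b where "poly p b \<noteq> 0"
    using assms(1) by (metis (mono_tags, lifting) finite_subset mem_Collect_eq subsetI)
  then show ?thesis using that by (simp add: p_def poly_sum poly_monom)
qed

text \<open>One variable at a time: \<open>b\<close> is chosen so that the coefficient of some power
  of \<open>a\<close>, a nonzero polynomial in \<open>b\<close>, survives; then \<open>a\<close>
  avoids the roots of the remaining polynomial.\<close>

lemma bivariate_nonzero_point:
  fixes u :: "nat \<times> nat \<Rightarrow> 'k::field"
  assumes "infinite (UNIV :: 'k set)" "t \<in> (SIGMA p:{..n}. {..n-p})" "u t \<noteq> 0"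
  obtains a b where "(\<Sum>(p,q)\<in>(SIGMA p:{..n}. {..n-p}). u (p,q) * (a ^ p * b ^ q)) \<noteq> 0"
proof -
  obtain p q where t: "t = (p,q)" "p \<le> n" "q \<le> n - p" using assms(2) by auto
  obtain b where b: "(\<Sum>q\<le>n-p. u (p,q) * b ^ q) \<noteq> 0"
    using poly_sum_nonzero_point[of q "n-p" "\<lambda>q. u (p,q)"] assms t by blast
  obtain a where a: "(\<Sum>p\<le>n. (\<Sum>q\<le>n-p. u (p,q) * b ^ q) * a ^ p) \<noteq> 0"
    using poly_sum_nonzero_point[of p n "\<lambda>p. \<Sum>q\<le>n-p. u (p,q) * b ^ q"] assms t b by blast
  have "(\<Sum>(p,q)\<in>(SIGMA p:{..n}. {..n-p}). u (p,q) * (a ^ p * b ^ q))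
      = (\<Sum>p\<le>n. \<Sum>q\<le>n-p. u (p,q) * (a ^ p * b ^ q))"
    by (subst sum.Sigma) auto
  also have "\<dots> = (\<Sum>p\<le>n. (\<Sum>q\<le>n-p. u (p,q) * b ^ q) * a ^ p)"
    by (simp add: sum_distrib_left sum_distrib_right mult_ac)
  finally have "(\<Sum>(p,q)\<in>(SIGMA p:{..n}. {..n-p}). u (p,q) * (a ^ p * b ^ q)) \<noteq> 0"
    using a by argo
  then show ?thesis by (rule that)
qed

text \<open>The pairs are the exponents of two of the variables in the monomials of degree
  \<open>n\<close> in three variables; the third exponent is \<open>n - p - q\<close>.\<close>

lemma card_triangle: "2 * card (SIGMA p:{..n::nat}. {..n-p}) = (n+1) * (n+2)"
proof -
  have "card (SIGMA p:{..n}. {..n-p}) = (\<Sum>p\<le>n. Suc (n - p))"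
    by simp
  also have "\<dots> = (\<Sum>p\<le>n. Suc p)"
    using sum.nat_diff_reindex[of Suc "Suc n"] by (simp add: lessThan_Suc_atMost)
  finally have "card (SIGMA p:{..n}. {..n-p}) = (\<Sum>p\<le>n. Suc p)" .
  moreover have "2 * (\<Sum>p\<le>n. Suc p) = (n+1) * (n+2)"
    by (induction n) auto
  ultimately show ?thesis by simp
qed

section \<open>Projections onto homogeneous components and the tail ideals\<close>

context graded_algebra
begin

lemma mult_scale: "x * scale c y = scale c (x * y)"
  using scale_mult[of c y x] by (simp add: mult.commute)

lemma subspace_mult_image: "subspace V \<Longrightarrow> subspace ((*) g ` V)"
  unfolding subspace_def
  by (auto simp: image_iff) (metis mult_zero_right, metis distrib_left, metis mult_scale)

lemma mult_span: "x \<in> span V \<Longrightarrow> g * x \<in> span ((*) g ` V)"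
proof (induction rule: span_induct_alt)
  case base
  then show ?case by (simp add: span_zero)
next
  case (step c x y)
  then show ?case
    by (simp add: distrib_left mult_scale span_add span_scale span_base)
qed

definition component :: "nat \<Rightarrow> 'a \<Rightarrow> 'a" where
  "component i x = (THE c. (\<forall>i. c i \<in> A i) \<and> finite {i. c i \<noteq> 0} \<and> x = (\<Sum>i | c i \<noteq> 0. c i)) i"

lemma component_props:
  "component i x \<in> A i" "finite {i. component i x \<noteq> 0}"
  "(\<Sum>i | component i x \<noteq> 0. component i x) = x"
  using theI'[OF direct_sum[of x]] unfolding component_def by auto

text \<open>\<open>F\<close> may be larger than the support of \<open>c\<close>, so a sum can be
  projected without determining where its terms cancel.\<close>

lemma component_eqI:
  assumes "\<And>i. c i \<in> A i" "finite F" "\<And>i. i \<notin> F \<Longrightarrow> c i = 0" "x = (\<Sum>i\<in>F. c i)"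
  shows "component i x = c i"
proof -
  have fin: "finite {i. c i \<noteq> 0}"
    by (rule finite_subset[OF _ assms(2)]) (use assms(3) in auto)
  have "(\<Sum>i\<in>F. c i) = (\<Sum>i | c i \<noteq> 0. c i)"
    by (rule sum.mono_neutral_right) (use assms in auto)
  then have "(\<forall>i. c i \<in> A i) \<and> finite {i. c i \<noteq> 0} \<and> x = (\<Sum>i | c i \<noteq> 0. c i)"
    using assms fin by simp
  then show ?thesis
    unfolding component_def by (subst the1_equality[OF direct_sum]) auto
qed

lemma component_homogeneous:
  assumes "x \<in> A k"
  shows "component i x = (if i = k then x else 0)"
  by (rule component_eqI[where F = "{k}"])
    (use assms subspace_0[OF subspace_component] in auto)

lemma component_add: "component i (x + y) = component i x + component i y"
proof -
  let ?X = "{i. component i x \<noteq> 0}" and ?Y = "{i. component i y \<noteq> 0}"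
  have "x = (\<Sum>i\<in>?X \<union> ?Y. component i x)"
    by (subst (1) component_props(3)[symmetric])
      (rule sum.mono_neutral_left, use component_props(2) in auto)
  moreover have "y = (\<Sum>i\<in>?X \<union> ?Y. component i y)"
    by (subst (1) component_props(3)[symmetric])
      (rule sum.mono_neutral_left, use component_props(2) in auto)
  ultimately have "x + y = (\<Sum>i\<in>?X \<union> ?Y. component i x + component i y)"
    by (simp add: sum.distrib)
  then show ?thesis
    by (intro component_eqI[where F = "?X \<union> ?Y"])
      (auto simp: component_props subspace_add[OF subspace_component])
qed

lemma component_scale: "component i (scale c x) = scale c (component i x)"
proof (rule component_eqI[where F = "{i. component i x \<noteq> 0}"])
  show "scale c x = (\<Sum>i | component i x \<noteq> 0. scale c (component i x))"
    by (subst (1) component_props(3)[symmetric]) (simp add: scale_sum_right)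
qed (auto simp: component_props subspace_scale[OF subspace_component])

text \<open>The projection is linear and either fixes or kills a homogeneous generator.\<close>

lemma component_span:
  assumes "x \<in> span (\<Union>k. B k)" "\<And>k. B k \<subseteq> A k"
  shows "component i x \<in> span (B i)"
  using assms(1)
proof (induction rule: span_induct_alt)
  case base
  then show ?case
    using component_homogeneous[of 0 0 i] subspace_0[OF subspace_component, of 0]
    by (auto simp: span_zero split: if_splits)
next
  case (step c x y)
  then obtain k where k: "x \<in> B k" by blast
  then have "component i x \<in> span (B i)"
    using component_homogeneous[of x k i] assms(2)[of k] by (auto simp: span_zero span_base subset_iff)
  with step show ?case
    by (simp add: component_add component_scale span_add span_scale)
qed

lemma span_components: "span (\<Union>i. A i) = UNIV"
proof -
  have "x \<in> span (\<Union>i. A i)" for x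
    by (subst component_props(3)[symmetric])
      (intro span_sum span_base, use component_props(1) in blast)
  then show ?thesis by blast
qed

text \<open>These ideals form the descending chain to which the Artinian condition is
  applied.\<close>

definition tail :: "nat \<Rightarrow> 'a set" where
  "tail n = span (\<Union>k\<in>{n..}. A k)"

lemma tail_ideal:
  assumes "x \<in> tail n"
  shows "y * x \<in> tail n"
proof -
  have *: "y * x \<in> tail n" if "x \<in> A k" "k \<ge> n" for x k
  proof -
    have "y \<in> span (\<Union>i. A i)" by (simp add: span_components)
    then show ?thesis
    proof (induction rule: span_induct_alt)
      case base
      then show ?case by (simp add: tail_def span_zero)
    next
      case (step c y z)
      then obtain i where "y \<in> A i" by blast
      then have "y * x \<in> A (i + k)" using mult_component that by blast
      then have "y * x \<in> tail n" unfolding tail_def using that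
        by (intro span_base UN_I[of "i+k"]) auto
      with step show ?case
        by (simp add: tail_def distrib_right scale_mult span_add span_scale)
    qed
  qed
  from assms show ?thesis
    unfolding tail_def
  proof (induction rule: span_induct_alt)
    case base
    then show ?case by (simp add: span_zero)
  next
    case (step c x z)
    then have "y * x \<in> tail n" using * by auto
    with step show ?case
      by (simp add: tail_def distrib_left mult_scale span_add span_scale)
  qed
qed

lemma tail_mono: "tail (Suc n) \<subseteq> tail n"
  unfolding tail_def by (intro span_mono UN_mono) auto

lemma tail_disjoint:
  assumes "x \<in> A n" "x \<in> tail (Suc n)"
  shows "x = 0"
proof -
  \<comment> \<open>With empty generating sets in degrees up to \<open>n\<close>, the tail becomes a
    span over all degrees, and \<open>component_span\<close> puts its degree \<open>n\<close> part
    into \<open>span {}\<close>.\<close>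
  have "(\<Union>k\<in>{Suc n..}. A k) = (\<Union>k. if k > n then A k else {})"
    by (auto split: if_splits simp: Suc_le_eq bex_simps)
  then have "component n x \<in> span {}"
    using component_span[of x "\<lambda>k. if k > n then A k else {}" n] assms(2)
    by (auto simp: tail_def)
  then show ?thesis using component_homogeneous[OF assms(1), of n] by simp
qed

end

section \<open>Ideals of two linear forms and the growth of the Hilbert function\<close>

context graded_algebra
begin

lemma power_component: "x \<in> A 1 \<Longrightarrow> x ^ n \<in> A n"
  by (induction n) (use one_component mult_component[of x 1] in auto)

lemma subspace_two_generated: "subspace U \<Longrightarrow> subspace V \<Longrightarrow> subspace {l * r + m * s |r s. r \<in> U \<and> s \<in> V}"
proof -
  assume UV: "subspace U" "subspace V"
  have "{l * r + m * s |r s. r \<in> U \<and> s \<in> V} = {x + y |x y. x \<in> (*) l ` U \<and> y \<in> (*) m ` V}"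
    by blast
  then show ?thesis
    using subspace_sums[OF subspace_mult_image[OF UV(1), of l] subspace_mult_image[OF UV(2), of m]]
    by simp
qed

text \<open>Each \<open>v\<close> in \<open>W\<close> acts on \<open>U\<close> as a linear
  functional with values in the line \<open>span {s}\<close>, and only 0 is killed by all of them.
  Passing to the kernel of one functional lowers the dimension by at most one, whence the induction
  on \<open>W\<close>.\<close>

lemma spanning_set_by_separation:
  assumes "finite W" "subspace U" "\<And>v u. v \<in> W \<Longrightarrow> u \<in> U \<Longrightarrow> v * u \<in> span {s}"
    and "\<And>u. u \<in> U \<Longrightarrow> \<forall>v\<in>W. v * u = 0 \<Longrightarrow> u = 0"
  shows "\<exists>B. finite B \<and> card B \<le> card W \<and> U \<subseteq> span B"
  using assms
proof (induction W arbitrary: U rule: finite_induct)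
  case empty
  then show ?case by (intro exI[of _ "{}"]) auto
next
  case (insert v W)
  define U' where "U' = {u \<in> U. v * u = 0}"
  have "subspace U'"
    using insert.prems(1) unfolding U'_def subspace_def
    by (auto simp: distrib_left mult_scale)
  moreover have "u = 0" if "u \<in> U'" "\<forall>v\<in>W. v * u = 0" for u
    using insert.prems(3)[of u] that by (auto simp: U'_def)
  ultimately obtain B where B: "finite B" "card B \<le> card W" "U' \<subseteq> span B"
    using insert.IH[of U'] insert.prems(2) unfolding U'_def by blast
  show ?case
  proof (cases "\<exists>w\<in>U. v * w \<noteq> 0")
    case False
    then have "U \<subseteq> span B" using B by (auto simp: U'_def)
    then show ?thesis using B insert.hyps by (intro exI[of _ B]) auto
  next
    case True
    then obtain w where w: "w \<in> U" "v * w \<noteq> 0" by blast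
    obtain a where a: "v * w = scale a s"
      using insert.prems(2)[of v w] w by (auto simp: span_singleton)
    with w have "a \<noteq> 0" by auto
    have "u \<in> span (insert w B)" if u: "u \<in> U" for u
    proof -
      obtain b where b: "v * u = scale b s"
        using insert.prems(2)[of v u] u by (auto simp: span_singleton)
      \<comment> \<open>The multiple of \<open>w\<close> with the same value under \<open>v\<close>
        is subtracted, which moves \<open>u\<close> into the kernel \<open>U'\<close>.\<close>
      have "v * (u - scale (b / a) w) = 0"
        using \<open>a \<noteq> 0\<close> by (simp add: right_diff_distrib mult_scale a b)
      then have "u - scale (b / a) w \<in> span B"
        using B u w insert.prems(1) by (auto simp: U'_def subspace_diff subspace_scale)
      then show ?thesis using span_breakdown_eq by blast
    qed
    moreover have "card (insert w B) \<le> card (insert v W)"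
      using B insert.hyps by (simp add: card_insert_if)
    ultimately show ?thesis using B by (intro exI[of _ "insert w B"]) auto
  qed
qed

text \<open>\<open>A\<^bsub>n-1\<^esub>\<close> with the convention \<open>A\<^bsub>-1\<^esub> = 0\<close>, which truncated subtraction would not give.\<close>

definition pred_component :: "nat \<Rightarrow> 'a set" where
  "pred_component n = (case n of 0 \<Rightarrow> {0} | Suc k \<Rightarrow> A k)"

lemma pred_component_simps [simp]: "pred_component 0 = {0}" "pred_component (Suc n) = A n"
  by (simp_all add: pred_component_def)

lemma subspace_pred_component: "subspace (pred_component n)"
  by (cases n) (auto simp: subspace_component)

lemma mult_pred_component: "w \<in> A 1 \<Longrightarrow> r \<in> pred_component n \<Longrightarrow> w * r \<in> pred_component (Suc n)"
  using mult_component[of w 1 r "n - 1"] subspace_0[OF subspace_component]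
  by (cases n) auto

text \<open>Modulo \<open>x - a z\<close> and \<open>y - b z\<close>, \<open>x\<close> becomes
  \<open>a z\<close> and \<open>y\<close> becomes \<open>b z\<close>. The induction replaces one
  factor at a time.\<close>

lemma monomial_congruence:
  assumes "y \<in> A 1" "x \<in> A 1" "z \<in> A 1"
  shows "x ^ p * y ^ q * z ^ r - scale (a ^ p * b ^ q) (z ^ (p + q + r)) \<in>
    {(x - scale a z) * u + (y - scale b z) * v |u v.
      u \<in> pred_component (p + q + r) \<and> v \<in> pred_component (p + q + r)}"
    (is "_ \<in> ?J (p + q + r)")
proof -
  have sub: "subspace (?J n)" for n
    by (intro subspace_two_generated subspace_pred_component)
  have multJ: "w * f \<in> ?J (Suc n)" if w: "w \<in> A 1" and f: "f \<in> ?J n" for w f n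
  proof -
    obtain u v where "f = (x - scale a z) * u + (y - scale b z) * v"
      "u \<in> pred_component n" "v \<in> pred_component n" using f by blast
    moreover from this have "w * f = (x - scale a z) * (w * u) + (y - scale b z) * (w * v)"
      by (simp only: distrib_left mult.left_commute[of w])
    ultimately show ?thesis using mult_pred_component[OF w] by blast
  qed
  have genx: "(x - scale a z) * f \<in> ?J (Suc n)" if "f \<in> A n" for f n
    unfolding mem_Collect_eq using that subspace_0[OF subspace_component]
    by (intro exI[of _ f] exI[of _ 0]) simp
  have geny: "(y - scale b z) * f \<in> ?J (Suc n)" if "f \<in> A n" for f n
    unfolding mem_Collect_eq using that subspace_0[OF subspace_component]
    by (intro exI[of _ 0] exI[of _ f]) simp
  show ?thesis
  proof (induction p)
    case 0
    show ?case
    proof (induction q)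
      case 0
      then show ?case using subspace_0[OF sub[of r]] by simp
    next
      case (Suc q)
      let ?n = "0 + q + r"
      \<comment> \<open>Multiplying the congruence by \<open>y\<close> leaves \<open>y z^n\<close>,
        which is replaced by \<open>b z^(n+1)\<close> at the cost of a multiple of
        \<open>y - b z\<close>.\<close>
      have "x ^ 0 * y ^ Suc q * z ^ r - scale (a ^ 0 * b ^ Suc q) (z ^ Suc ?n) =
          y * (x ^ 0 * y ^ q * z ^ r - scale (a ^ 0 * b ^ q) (z ^ ?n))
          + scale (a ^ 0 * b ^ q) ((y - scale b z) * z ^ ?n)"
        by (simp add: algebra_simps scale_mult mult_scale scale_right_diff_distrib)
      moreover have "\<dots> \<in> ?J (Suc ?n)"
        using Suc assms power_component
        by (intro subspace_add[OF sub] subspace_scale[OF sub] multJ geny) auto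
      ultimately show ?case by simp
    qed
  next
    case (Suc p)
    let ?n = "p + q + r"
    have "x ^ Suc p * y ^ q * z ^ r - scale (a ^ Suc p * b ^ q) (z ^ Suc ?n) =
        x * (x ^ p * y ^ q * z ^ r - scale (a ^ p * b ^ q) (z ^ ?n))
        + scale (a ^ p * b ^ q) ((x - scale a z) * z ^ ?n)"
      by (simp add: algebra_simps scale_mult mult_scale scale_right_diff_distrib)
    moreover have "\<dots> \<in> ?J (Suc ?n)"
      using Suc assms power_component
      by (intro subspace_add[OF sub] subspace_scale[OF sub] multJ genx) auto
    ultimately show ?case by simp
  qed
qed

text \<open>For linear forms \<open>l\<close> and \<open>m\<close> this says that
  \<open>A / (l, m)\<close> vanishes in degree \<open>i + 1\<close>; the index is the degree of the
  cofactors.\<close>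

definition two_generated :: "'a \<Rightarrow> 'a \<Rightarrow> nat \<Rightarrow> bool" where
  "two_generated l m i \<longleftrightarrow> (\<forall>w\<in>A (Suc i). \<exists>r\<in>A i. \<exists>s\<in>A i. w = l * r + m * s)"

text \<open>This compares the dimensions of \<open>A / l A\<close> in degrees \<open>k + 2\<close>
  and \<open>k + 1\<close>, between which multiplication by \<open>m\<close> is onto. The ranks are
  moved across to avoid truncated subtraction.\<close>

lemma hilbert_function_step:
  assumes "two_generated l m (Suc k)" "l \<in> A 1" "m \<in> A 1" "\<And>i. \<exists>W. finite W \<and> A i \<subseteq> span W"
  shows "dim (A (Suc (Suc k))) + dim ((*) l ` A k) \<le> dim (A (Suc k)) + dim ((*) l ` A (Suc k))"
proof -
  have lk: "(*) l ` A i \<subseteq> A (Suc i)" for i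
    using mult_component[OF assms(2), of _ i] by auto
  obtain W where W: "finite W" "A (Suc k) \<subseteq> span W" using assms(4) by blast
  obtain W' where W': "finite W'" "A (Suc (Suc k)) \<subseteq> span W'" using assms(4) by blast
  \<comment> \<open>\<open>B\<close> spans \<open>l A_k\<close>, and \<open>C\<close> represents a
    basis of \<open>A / l A\<close> in degree \<open>k + 1\<close>.\<close>
  obtain B C where "(*) l ` A k \<subseteq> span B" "card B = dim ((*) l ` A k)" and
    BC: "B \<subseteq> (*) l ` A k" "finite B" "C \<subseteq> A (Suc k)" "finite C"
    "A (Suc k) \<subseteq> span (B \<union> C)" "dim (A (Suc k)) = dim ((*) l ` A k) + card C"
    by (rule dim_basis_extend[OF W(2,1) lk[of k]])
  obtain D where "D \<subseteq> (*) l ` A (Suc k)" "independent D" and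
    D: "finite D" "(*) l ` A (Suc k) \<subseteq> span D" "card D = dim ((*) l ` A (Suc k))"
    by (rule dim_basis[OF order_trans[OF lk[of "Suc k"] W'(2)] W'(1)])
  have "(*) m ` B \<subseteq> span D"
  proof
    fix v assume "v \<in> (*) m ` B"
    then obtain a where a: "a \<in> A k" "v = m * (l * a)" using BC(1) by blast
    then have "v = l * (m * a)" by (simp add: mult_ac)
    moreover have "m * a \<in> A (Suc k)" using mult_component[OF assms(3) a(1)] by simp
    ultimately show "v \<in> span D" using D(2) by blast
  qed
  \<comment> \<open>\<open>m\<close> maps \<open>l A_k\<close> into \<open>l A_(k+1)\<close>,
    already spanned by \<open>D\<close>, so only the images of \<open>C\<close> are new.\<close>
  then have mBC: "(*) m ` (B \<union> C) \<subseteq> span (D \<union> (*) m ` C)"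
    using span_mono[of D "D \<union> (*) m ` C"] by (auto intro: span_base)
  have "A (Suc (Suc k)) \<subseteq> span (D \<union> (*) m ` C)"
  proof
    fix w assume "w \<in> A (Suc (Suc k))"
    then obtain r s where rs: "r \<in> A (Suc k)" "s \<in> A (Suc k)" "w = l * r + m * s"
      using assms(1) unfolding two_generated_def by blast
    have "l * r \<in> span (D \<union> (*) m ` C)"
      using D(2) rs(1) span_mono[of D "D \<union> (*) m ` C"] by auto
    moreover have "m * s \<in> span ((*) m ` (B \<union> C))"
      using rs(2) BC(5) by (intro mult_span) auto
    then have "m * s \<in> span (D \<union> (*) m ` C)"
      using span_minimal[OF mBC] by auto
    ultimately show "w \<in> span (D \<union> (*) m ` C)" using rs(3) span_add by blast
  qed
  then have "dim (A (Suc (Suc k))) \<le> card (D \<union> (*) m ` C)"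
    using D BC by (intro dim_le_card) auto
  also have "\<dots> \<le> card D + card C"
    using card_Un_le[of D "(*) m ` C"] card_image_le[OF BC(4), of "(*) m"] by linarith
  finally show ?thesis using BC D by simp
qed

end

section \<open>Monomials in three linear generators\<close>

context standard_graded_algebra
begin

context
  fixes x y z
  assumes generators: "span {x, y, z} = A 1"
begin

lemma generators_component: "x \<in> A 1" "y \<in> A 1" "z \<in> A 1"
  using generators span_base[of _ "{x,y,z}"] by auto

abbreviation exponents :: "nat \<Rightarrow> (nat \<times> nat) set" where
  "exponents n \<equiv> SIGMA p:{..n}. {..n-p}"

abbreviation monomial :: "nat \<Rightarrow> nat \<times> nat \<Rightarrow> 'b" where
  "monomial n \<equiv> \<lambda>(p,q). x ^ p * y ^ q * z ^ (n - p - q)"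

lemma monomial_component: "monomial n ` exponents n \<subseteq> A n"
proof
  fix v assume "v \<in> monomial n ` exponents n"
  then obtain p q where pq: "p \<le> n" "q \<le> n - p" "v = x ^ p * y ^ q * z ^ (n - p - q)" by auto
  have "x ^ p * y ^ q * z ^ (n - p - q) \<in> A (p + q + (n - p - q))"
    by (intro mult_component power_component generators_component)
  moreover have "p + q + (n - p - q) = n" using pq by simp
  ultimately show "v \<in> A n" using pq(3) by simp
qed

lemma monomial_in_image: "x ^ p * y ^ q * z ^ r \<in> monomial (p + q + r) ` exponents (p + q + r)"
  by (rule image_eqI[of _ _ "(p,q)"]) auto

text \<open>The span of all monomials is closed under products and contains 1 and
  \<open>A 1\<close>, so it is the whole algebra; projecting to degree \<open>n\<close> keeps only
  the monomials of that degree.\<close>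

lemma component_eq_span_monomials: "A n = span (monomial n ` exponents n)"
proof
  let ?M = "\<Union>n. monomial n ` exponents n"
  have M: "x ^ p * y ^ q * z ^ r \<in> ?M" for p q r
    using monomial_in_image by blast
  have multM: "v * w \<in> span ?M" if v: "v \<in> ?M" and w: "w \<in> ?M" for v w
  proof -
    obtain p q r p' q' r' where "v = x ^ p * y ^ q * z ^ r" "w = x ^ p' * y ^ q' * z ^ r'"
      using v w by auto
    then have "v * w = x ^ (p + p') * y ^ (q + q') * z ^ (r + r')"
      by (simp add: power_add mult_ac)
    then show ?thesis using span_base[OF M[of "p + p'" "q + q'" "r + r'"]] by simp
  qed
  have mult1: "v * w \<in> span ?M" if "v \<in> ?M" "w \<in> span ?M" for v w
  proof -
    have "(*) v ` ?M \<subseteq> span ?M" using multM[OF that(1)] by blast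
    from subsetD[OF span_minimal[OF this subspace_span] mult_span[OF that(2)]] show ?thesis .
  qed
  have mult: "v * w \<in> span ?M" if "v \<in> span ?M" "w \<in> span ?M" for v w
  proof -
    have "(*) w ` ?M \<subseteq> span ?M"
      by (rule image_subsetI, subst mult.commute) (rule mult1[OF _ that(2)])
    from subsetD[OF span_minimal[OF this subspace_span] mult_span[OF that(1)]]
    show ?thesis by (simp only: mult.commute[of v])
  qed
  have "1 \<in> span ?M" using span_base[OF M[of 0 0 0]] by simp
  moreover have "A 1 \<subseteq> span ?M"
  proof -
    have "{x, y, z} \<subseteq> span ?M"
      using span_base[OF M[of 1 0 0]] span_base[OF M[of 0 1 0]] span_base[OF M[of 0 0 1]] by simp
    from span_minimal[OF this subspace_span] show ?thesis by (simp only: generators)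
  qed
  ultimately have "span ?M = UNIV"
    using generated_in_degree_1[OF subspace_span _ mult] by blast
  then have comp: "component n v \<in> span (monomial n ` exponents n)" for v
    using component_span[of v "\<lambda>n. monomial n ` exponents n", OF _ monomial_component]
    by blast
  have "v \<in> span (monomial n ` exponents n)" if "v \<in> A n" for v
    using comp[of v] by (simp only: component_homogeneous[OF that] if_True simp_thms)
  then show "A n \<subseteq> span (monomial n ` exponents n)" by blast
  show "span (monomial n ` exponents n) \<subseteq> A n"
    by (intro span_minimal monomial_component subspace_component)
qed

lemma finite_exponents: "finite (exponents n)" by auto

lemma component_finite: "\<exists>W. finite W \<and> A n \<subseteq> span W"
  using component_eq_span_monomials finite_exponents by blast

lemma dim_component_le: "dim (A n) \<le> card (exponents n)"
proof -
  have "dim (A n) \<le> card (monomial n ` exponents n)"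
    using component_eq_span_monomials finite_exponents by (intro dim_le_card) auto
  also have "\<dots> \<le> card (exponents n)" by (rule card_image_le) (rule finite_exponents)
  finally show ?thesis .
qed

text \<open>A monomial of positive degree contains one of the generators, which is split
  off.\<close>

lemma component_Suc:
  assumes "w \<in> A (Suc n)"
  shows "\<exists>r\<in>A n. \<exists>s\<in>A n. \<exists>t\<in>A n. w = x * r + y * s + z * t"
proof -
  have "w \<in> span (monomial (Suc n) ` exponents (Suc n))"
    using assms component_eq_span_monomials by blast
  then show ?thesis
  proof (induction rule: span_induct_alt)
    case base
    show ?case using subspace_0[OF subspace_component, of n] by (intro bexI[of _ 0]) auto
  next
    case (step c v w)
    then obtain p q where pq: "p \<le> Suc n" "q \<le> Suc n - p"
      "v = x ^ p * y ^ q * z ^ (Suc n - p - q)" by auto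
    have 0: "0 \<in> A n" by (rule subspace_0[OF subspace_component])
    have mon: "x ^ p * y ^ q * z ^ r \<in> A n" if "p + q + r = n" for p q r
      using monomial_in_image[of p q r] monomial_component that by blast
    have "\<exists>r\<in>A n. \<exists>s\<in>A n. \<exists>t\<in>A n. v = x * r + y * s + z * t"
    proof (cases p)
      case (Suc p')
      then have "x ^ p' * y ^ q * z ^ (Suc n - p - q) \<in> A n" using pq by (intro mon) auto
      moreover have "v = x * (x ^ p' * y ^ q * z ^ (Suc n - p - q)) + y * 0 + z * 0"
        using pq Suc by (simp add: mult_ac)
      ultimately show ?thesis using 0 by blast
    next
      case p: 0
      show ?thesis
      proof (cases q)
        case (Suc q')
        then have "x ^ 0 * y ^ q' * z ^ (Suc n - p - q) \<in> A n" using pq p by (intro mon) auto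
        moreover have "v = x * 0 + y * (x ^ 0 * y ^ q' * z ^ (Suc n - p - q)) + z * 0"
          using pq Suc p by (simp add: mult_ac)
        ultimately show ?thesis using 0 by blast
      next
        case q: 0
        have "x ^ 0 * y ^ 0 * z ^ n \<in> A n" by (intro mon) auto
        moreover have "v = x * 0 + y * 0 + z * (x ^ 0 * y ^ 0 * z ^ n)"
          using pq p q by simp
        ultimately show ?thesis using 0 by blast
      qed
    qed
    then obtain r s t where v: "r \<in> A n" "s \<in> A n" "t \<in> A n" "v = x * r + y * s + z * t" by blast
    obtain r' s' t' where w: "r' \<in> A n" "s' \<in> A n" "t' \<in> A n" "w = x * r' + y * s' + z * t'"
      using step by blast
    have "scale c v + w = x * (scale c r + r') + y * (scale c s + s') + z * (scale c t + t')"
      by (simp add: v w distrib_left scale_right_distrib mult_scale algebra_simps)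
    moreover have "scale c r + r' \<in> A n" "scale c s + s' \<in> A n" "scale c t + t' \<in> A n"
      using v w subspace_component subspace_add subspace_scale by blast+
    ultimately show ?case by blast
  qed
qed

text \<open>The cofactors of \<open>x\<close>, \<open>y\<close>, \<open>z\<close> lie in degree
  \<open>i + 1\<close>, so each splits along \<open>l\<close> and \<open>m\<close>; regrouping gives
  cofactors one degree higher.\<close>

lemma two_generated_Suc:
  assumes "two_generated l m i"
  shows "two_generated l m (Suc i)"
  unfolding two_generated_def
proof
  fix w assume "w \<in> A (Suc (Suc i))"
  then obtain r s t where w: "r \<in> A (Suc i)" "s \<in> A (Suc i)" "t \<in> A (Suc i)"
    "w = x * r + y * s + z * t"
    using component_Suc by blast
  obtain r1 r2 where r: "r1 \<in> A i" "r2 \<in> A i" "r = l * r1 + m * r2"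
    using assms w unfolding two_generated_def by blast
  obtain s1 s2 where s: "s1 \<in> A i" "s2 \<in> A i" "s = l * s1 + m * s2"
    using assms w unfolding two_generated_def by blast
  obtain t1 t2 where t: "t1 \<in> A i" "t2 \<in> A i" "t = l * t1 + m * t2"
    using assms w unfolding two_generated_def by blast
  have gen: "x * a + y * b + z * c \<in> A (Suc i)" if "a \<in> A i" "b \<in> A i" "c \<in> A i" for a b c
    using mult_component[of _ 1 _ i] generators_component that subspace_component
    by (intro subspace_add) auto
  have "w = l * (x * r1 + y * s1 + z * t1) + m * (x * r2 + y * s2 + z * t2)"
    by (simp add: w r s t algebra_simps)
  then show "\<exists>r\<in>A (Suc i). \<exists>s\<in>A (Suc i). w = l * r + m * s"
    using gen[of r1 s1 t1] gen[of r2 s2 t2] r s t by blast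
qed

lemma two_generated_mono: "i \<le> k \<Longrightarrow> two_generated l m i \<Longrightarrow> two_generated l m k"
  by (induction k rule: dec_induct) (auto intro: two_generated_Suc)

text \<open>Independent monomials give the largest possible dimension. A relation among them,
  evaluated at a point where it does not vanish, yields the two linear forms.\<close>

lemma two_generated_or_dim_maximal:
  assumes "infinite (UNIV :: 'a set)"
  shows "(\<exists>l\<in>A 1. \<exists>m\<in>A 1. two_generated l m i) \<or> dim (A (Suc i)) = card (exponents (Suc i))"
proof (cases "\<forall>u. (\<Sum>t\<in>exponents (Suc i). scale (u t) (monomial (Suc i) t)) = 0
    \<longrightarrow> (\<forall>t\<in>exponents (Suc i). u t = 0)")
  case True
  then have inj: "inj_on (monomial (Suc i)) (exponents (Suc i))"
    and ind: "independent (monomial (Suc i) ` exponents (Suc i))"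
    using independent_family[OF finite_exponents, where f = "monomial (Suc i)"] by blast+
  have "dim (A (Suc i)) = card (monomial (Suc i) ` exponents (Suc i))"
    using dim_eq_card_independent[OF ind]
    by (simp only: component_eq_span_monomials[of "Suc i"] dim_span)
  also have "\<dots> = card (exponents (Suc i))"
    by (rule card_image[OF inj])
  finally have "dim (A (Suc i)) = card (exponents (Suc i))" .
  then show ?thesis by blast
next
  case False
  let ?n = "Suc i"
  let ?T = "exponents ?n"
  obtain u t where u: "(\<Sum>t\<in>?T. scale (u t) (monomial ?n t)) = 0" "t \<in> ?T" "u t \<noteq> 0"
    using False by blast
  obtain a b where ab: "(\<Sum>(p,q)\<in>?T. u (p,q) * (a ^ p * b ^ q)) \<noteq> 0"
    using bivariate_nonzero_point[of t ?n u] assms u by blast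
  define l where "l = x - scale a z"
  define m where "m = y - scale b z"
  define J where "J = {l * r + m * s |r s. r \<in> A i \<and> s \<in> A i}"
  have subJ: "subspace J" unfolding J_def by (intro subspace_two_generated subspace_component)
  have cong: "monomial ?n (p,q) - scale (a ^ p * b ^ q) (z ^ ?n) \<in> J" if "(p,q) \<in> ?T" for p q
  proof -
    have "p + q + (?n - p - q) = ?n" using that by auto
    then show ?thesis
      using monomial_congruence[of y x z p q "?n - p - q" a b] generators_component
      unfolding J_def l_def m_def by simp
  qed
  define k where "k = (\<Sum>(p,q)\<in>?T. u (p,q) * (a ^ p * b ^ q))"
  \<comment> \<open>Reducing the relation modulo \<open>l\<close> and \<open>m\<close> leaves
    \<open>- k z^n\<close> in \<open>J\<close>, where \<open>k\<close> is its nonzero value at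
    \<open>(a, b, 1)\<close>; hence \<open>z^n\<close> lies in \<open>J\<close>.\<close>
  have "(\<Sum>(p,q)\<in>?T. scale (u (p,q)) (monomial ?n (p,q) - scale (a ^ p * b ^ q) (z ^ ?n))) \<in> J"
    using cong by (intro subspace_sum[OF subJ]) (auto simp only: split: prod.split intro!: subspace_scale[OF subJ])
  also have "(\<Sum>(p,q)\<in>?T. scale (u (p,q)) (monomial ?n (p,q) - scale (a ^ p * b ^ q) (z ^ ?n)))
     = (\<Sum>t\<in>?T. scale (u t) (monomial ?n t)) - scale k (z ^ ?n)"
    by (simp only: k_def scale_sum_left scale_right_diff_distrib sum_subtractf[symmetric] split_def
        scale_scale prod.collapse)
  finally have "- scale k (z ^ ?n) \<in> J" by (simp only: u(1) diff_0)
  from subspace_scale[OF subJ this, of "- inverse k"] have z: "z ^ ?n \<in> J"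
    using ab by (simp add: k_def[symmetric] del: power_Suc)
  have "monomial ?n ` ?T \<subseteq> J"
  proof
    fix v assume "v \<in> monomial ?n ` ?T"
    then obtain p q where pq: "(p,q) \<in> ?T" "v = monomial ?n (p,q)" by blast
    have "(v - scale (a ^ p * b ^ q) (z ^ ?n)) + scale (a ^ p * b ^ q) (z ^ ?n) \<in> J"
      using cong[OF pq(1)] z pq(2) by (intro subspace_add[OF subJ] subspace_scale[OF subJ]) auto
    then show "v \<in> J" by simp
  qed
  then have "A ?n \<subseteq> J" using component_eq_span_monomials[of ?n] span_minimal[OF _ subJ] by blast
  then have "two_generated l m i" unfolding two_generated_def J_def by blast
  moreover have "l \<in> A 1" "m \<in> A 1"
    using generators_component subspace_component
    by (auto simp: l_def m_def intro!: subspace_diff subspace_scale)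
  ultimately show ?thesis by blast
qed

end

end

section \<open>The socle and the Gorenstein pairing\<close>

context artinian_gorenstein_algebra
begin

text \<open>Once the chain of tails is stationary, \<open>A m\<close> lies in
  \<open>tail (Suc m)\<close>, which it meets only in 0.\<close>

lemma component_eventually_zero: "\<exists>n. \<forall>m\<ge>n. A m = {0}"
proof -
  interpret ring: module "(*) :: 'b \<Rightarrow> 'b \<Rightarrow> 'b"
    by unfold_locales (simp_all add: algebra_simps)
  have "ring.subspace (tail n)" for n
    unfolding ring.subspace_def using tail_ideal
    by (auto simp: tail_def span_zero intro: span_add)
  then obtain n where n: "\<forall>m\<ge>n. tail m = tail n"
    using descending_chain_condition[of tail] tail_mono by blast
  have "A m = {0}" if "m \<ge> n" for m
  proof -
    have "A m \<subseteq> tail m" unfolding tail_def by (intro subsetI span_base UN_I[of m]) auto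
    moreover have "tail m = tail (Suc m)" using n that by (metis le_SucI)
    ultimately have "x = 0" if "x \<in> A m" for x using tail_disjoint[OF that] that by blast
    then show ?thesis using subspace_0[OF subspace_component, of m] by blast
  qed
  then show ?thesis by blast
qed

lemma socle_generator:
  obtains s where "s \<noteq> 0" "socle = span {s}"
proof -
  have sub: "subspace socle"
    unfolding socle_def subspace_def by (auto simp: distrib_left mult_scale)
  obtain B where B: "B \<subseteq> socle" "independent B" "socle \<subseteq> span B" "card B = dim socle"
    by (rule basis_exists)
  then obtain s where s: "B = {s}" using dim_socle by (metis card_1_singletonE)
  then have "s \<noteq> 0" using B(2) dependent_zero by blast
  moreover have "span B = socle"
    using B sub by (simp add: span_minimal subset_antisym)
  ultimately show ?thesis using that s by metis
qed

lemma one_neq_zero: "(1::'b) \<noteq> 0"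
proof
  assume "(1::'b) = 0"
  then have "s = 0" for s :: 'b by (metis mult_1 mult_zero_left)
  then show False using socle_generator by metis
qed

text \<open>The top nonzero component is killed by all elements of positive degree, so it lies in
  the socle. As the socle is a line, the two coincide.\<close>

lemma socle_degree_props:
  shows component_above_socle_degree: "i > socle_degree \<Longrightarrow> A i = {0}"
    and socle_eq_component: "socle = A socle_degree"
proof -
  obtain n where n: "\<forall>m\<ge>n. A m = {0}" using component_eventually_zero by blast
  define e where "e = (GREATEST i. A i \<noteq> {0})"
  have "A 0 \<noteq> {0}" using one_component one_neq_zero by auto
  moreover have bound: "\<forall>i. A i \<noteq> {0} \<longrightarrow> i \<le> n" using n nat_le_linear by blast
  ultimately have e: "A e \<noteq> {0}"
    unfolding e_def using GreatestI_nat[of "\<lambda>i. A i \<noteq> {0}" 0 n] by simp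
  have above: "A i = {0}" if "i > e" for i
    using Greatest_le_nat[of "\<lambda>i. A i \<noteq> {0}" i n] bound that unfolding e_def by fastforce
  have e_socle: "A e \<subseteq> socle"
  proof
    fix x assume x: "x \<in> A e"
    have "y * x = 0" if "y \<in> maximal_homogeneous_ideal" for y
      using that unfolding maximal_homogeneous_ideal_def
    proof (induction rule: span_induct_alt)
      case (step c y z)
      then obtain k where k: "k \<ge> 1" "y \<in> A k" by auto
      then have "y * x \<in> A (k + e)" using mult_component x by blast
      then have "y * x = 0" using above[of "k + e"] k by auto
      with step show ?case by (simp add: distrib_right scale_mult)
    qed simp
    then show "x \<in> socle" unfolding socle_def by blast
  qed
  obtain s where s: "socle = span {s}" by (rule socle_generator)
  obtain v where v: "v \<in> A e" "v \<noteq> 0" using e subspace_0[OF subspace_component, of e] by blast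
  obtain c where c: "v = scale c s" using v(1) e_socle s by (auto simp: span_singleton)
  then have "s = scale (inverse c) v" using v(2) by auto
  then have "s \<in> A e" using v(1) subspace_scale[OF subspace_component] by blast
  then have eq: "socle = A e"
    using e_socle s span_minimal[OF _ subspace_component] by blast
  have "i = e" if x: "x \<in> socle" "x \<in> A i" "x \<noteq> 0" for x i
  proof (rule ccontr)
    assume "i \<noteq> e"
    moreover have "x \<in> A e" using x eq by blast
    ultimately show False
      using component_homogeneous[OF x(2), of i] component_homogeneous[of x e i] x(3) by auto
  qed
  then have "socle_degree = e"
    unfolding socle_degree_def using v eq by (intro Greatest_equality) auto
  then show "i > socle_degree \<Longrightarrow> A i = {0}" "socle = A socle_degree"
    using above eq by auto
qed

text \<open>Below the socle degree a nonzero homogeneous element is not in the socle, so some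
  homogeneous factor of positive degree keeps it nonzero; repeating this ends in the socle
  degree.\<close>

lemma nondegenerate:
  assumes "x \<in> A i" "x \<noteq> 0"
  shows "i \<le> socle_degree \<and> (\<exists>y\<in>A (socle_degree - i). y * x \<noteq> 0)"
  using assms
proof (induction "socle_degree - i" arbitrary: i x rule: less_induct)
  case less
  have i: "i \<le> socle_degree"
    using component_above_socle_degree[of i] less.prems by (metis not_le singletonD)
  show ?case
  proof (cases "i = socle_degree")
    case True
    then show ?thesis using less.prems one_component by (auto intro: bexI[of _ 1])
  next
    case False
    have "x \<notin> socle"
    proof
      assume "x \<in> socle"
      then have "x \<in> A socle_degree" using socle_eq_component by simp
      then show False
        using component_homogeneous[of x socle_degree i] component_homogeneous[of x i i]
          less.prems False by simp
    qed
    then obtain y where y: "y \<in> maximal_homogeneous_ideal" "y * x \<noteq> 0"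
      unfolding socle_def by blast
    have "\<exists>k\<ge>1. \<exists>w\<in>A k. w * x \<noteq> 0"
    proof (rule ccontr)
      assume none: "\<not> ?thesis"
      have "y * x = 0"
        using y(1) unfolding maximal_homogeneous_ideal_def
      proof (induction rule: span_induct_alt)
        case (step c y z)
        then have "y * x = 0" using none by auto
        with step show ?case by (simp add: distrib_right scale_mult)
      qed simp
      then show False using y(2) by blast
    qed
    then obtain k w where w: "k \<ge> 1" "w \<in> A k" "w * x \<noteq> 0" by blast
    have "socle_degree - (k + i) < socle_degree - i" using w(1) i False by linarith
    from less.hyps[OF this mult_component[OF w(2) less.prems(1)] w(3)]
    obtain v where v: "k + i \<le> socle_degree" "v \<in> A (socle_degree - (k + i))"
      "v * (w * x) \<noteq> 0" by blast
    have "v * w \<in> A (socle_degree - (k + i) + k)" using mult_component v(2) w(2) by blast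
    moreover have "socle_degree - (k + i) + k = socle_degree - i" using v(1) by simp
    ultimately show ?thesis
      using i v(3) by (intro conjI bexI[of _ "v * w"]) (simp_all add: mult.assoc)
  qed
qed

text \<open>Multiplication pairs \<open>g A\<^sub>i\<close> with \<open>g A\<^sub>k\<close> through \<open>(ga, gb) \<mapsto> gab\<close>, and this pairing is nondegenerate.\<close>

lemma dim_mult_image_le:
  assumes "g \<in> A m" "i + m + k = socle_degree" "\<And>i. \<exists>W. finite W \<and> A i \<subseteq> span W"
  shows "dim ((*) g ` A i) \<le> dim ((*) g ` A k)"
proof -
  have gk: "(*) g ` A k \<subseteq> A (m + k)" using mult_component[OF assms(1)] by auto
  obtain W where W: "finite W" "A (m + k) \<subseteq> span W" using assms(3) by blast
  obtain B where "independent B" and B: "B \<subseteq> (*) g ` A k" "finite B"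
    "(*) g ` A k \<subseteq> span B" "card B = dim ((*) g ` A k)"
    by (rule dim_basis[OF order_trans[OF gk W(2)] W(1)])
  have "\<forall>w\<in>B. \<exists>b. b \<in> A k \<and> w = g * b" using B(1) by blast
  from bchoice[OF this] obtain f where f: "\<forall>w\<in>B. f w \<in> A k \<and> w = g * f w" by blast
  obtain s where s: "socle = span {s}" by (rule socle_generator)
  \<comment> \<open>The elements \<open>f w\<close>, lifts of a basis of \<open>g A_k\<close>, act
    on \<open>g A_i\<close> with values in the socle, a line.\<close>
  have "\<exists>C. finite C \<and> card C \<le> card (f ` B) \<and> (*) g ` A i \<subseteq> span C"
  proof (rule spanning_set_by_separation[where s = s])
    show "finite (f ` B)" using B by simp
    show "subspace ((*) g ` A i)" by (intro subspace_mult_image subspace_component)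
    show "v * u \<in> span {s}" if v: "v \<in> f ` B" and u: "u \<in> (*) g ` A i" for v u
    proof -
      obtain a where a: "a \<in> A i" "u = g * a" using u by blast
      have "v \<in> A k" using v f by blast
      then have "v * u \<in> A (k + (m + i))" unfolding a(2)
        by (intro mult_component assms(1) a(1))
      moreover have "k + (m + i) = socle_degree" using assms(2) by simp
      ultimately show ?thesis using socle_eq_component s by simp
    qed
    show "u = 0" if u: "u \<in> (*) g ` A i" and uB: "\<forall>v\<in>f ` B. v * u = 0" for u
    proof (rule ccontr)
      assume u0: "u \<noteq> 0"
      obtain a where a: "a \<in> A i" "u = g * a" using u by blast
      \<comment> \<open>Since \<open>f w * u = a * w\<close>, an element \<open>u = g * a\<close>
        killed by all \<open>f w\<close> forces \<open>a\<close> to annihilate \<open>g A_k\<close>,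
        against nondegeneracy at \<open>u\<close>.\<close>
      have zero: "a * w = 0" if "w \<in> span B" for w
        using that
      proof (induction rule: span_induct_alt)
        case (step c w z)
        have "w * a = f w * u" using bspec[OF f step(1)] a(2) by (metis mult.assoc mult.commute)
        also have "\<dots> = 0" using uB step(1) by blast
        finally show ?case using step by (simp add: distrib_left mult_scale mult.commute[of a w])
      qed simp
      have "u \<in> A (m + i)" using mult_component[OF assms(1) a(1)] a(2) by simp
      from nondegenerate[OF this u0] obtain y where
        y: "y \<in> A (socle_degree - (m + i))" "y * u \<noteq> 0" by blast
      have "socle_degree - (m + i) = k" using assms(2) by simp
      then have "g * y \<in> span B" using y(1) B(3) by auto
      then have "a * (g * y) = 0" by (rule zero)
      then show False using y(2) a(2) by (simp add: mult_ac)
    qed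
  qed
  then obtain C where C: "finite C" "card C \<le> card (f ` B)" "(*) g ` A i \<subseteq> span C" by blast
  have "dim ((*) g ` A i) \<le> card C" by (intro dim_le_card C)
  also have "\<dots> \<le> card B" using C(2) card_image_le[OF B(2), of f] by linarith
  finally show ?thesis using B(4) by simp
qed

text \<open>With \<open>g = 1\<close> this is the symmetry of the Hilbert function; with a linear
  form \<open>g\<close> it is the symmetry of the ranks.\<close>

lemma dim_mult_image_symmetric:
  assumes "g \<in> A m" "i + m + k = socle_degree" "\<And>i. \<exists>W. finite W \<and> A i \<subseteq> span W"
  shows "dim ((*) g ` A i) = dim ((*) g ` A k)"
proof (rule antisym)
  show "dim ((*) g ` A i) \<le> dim ((*) g ` A k)" by (rule dim_mult_image_le[OF assms])
  have "k + m + i = socle_degree" using assms(2) by simp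
  then show "dim ((*) g ` A k) \<le> dim ((*) g ` A i)" by (rule dim_mult_image_le[OF assms(1) _ assms(3)])
qed

end

section \<open>Log-concavity\<close>

text \<open>From \<open>(a - b)^2 \<ge> 0\<close>, that is, \<open>4 a b \<le> (a + b)^2\<close>; so
  concavity implies log-concavity.\<close>

lemma le_square_of_add_le:
  fixes a b c :: nat
  assumes "a + b \<le> 2 * c"
  shows "a * b \<le> c\<^sup>2"
proof -
  have "4 * (int a * int b) \<le> (int a + int b)\<^sup>2"
    using zero_le_power2[of "int a - int b"] by (simp add: power2_eq_square algebra_simps)
  also have "\<dots> \<le> (2 * int c)\<^sup>2" using assms by (intro power_mono) auto
  finally have "int (a * b) \<le> int (c\<^sup>2)" by (simp add: power2_eq_square)
  then show ?thesis by (simp only: of_nat_le_iff)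
qed

text \<open>\<open>a\<close> and \<open>c\<close> are consecutive triangular numbers and
  \<open>b\<close> is at most the next one; the claim reduces to
  \<open>i (i + 3) \<le> (i + 1) (i + 2)\<close>.\<close>

lemma triangular_log_concave:
  fixes a b c i :: nat
  assumes "2 * a = i * (i + 1)" "2 * c = (i + 1) * (i + 2)" "2 * b \<le> (i + 2) * (i + 3)"
  shows "a * b \<le> c\<^sup>2"
proof -
  have "(2 * a) * (2 * b) \<le> (i * (i + 1)) * ((i + 2) * (i + 3))"
    unfolding assms(1) by (intro mult_le_mono assms order.refl)
  also have "\<dots> \<le> ((i + 1) * (i + 2)) * ((i + 1) * (i + 2))"
    by (simp add: algebra_simps)
  also have "\<dots> = (2 * c) * (2 * c)" by (simp only: assms(2))
  finally show ?thesis by (simp add: power2_eq_square)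
qed

context artinian_gorenstein_algebra
begin

lemma hilbert_function_log_concave:
  assumes inf: "infinite (UNIV :: 'a set)" and three: "hilbert_function 1 = 3"
    and i: "1 \<le> i" "i \<le> socle_degree - 1"
  shows "hilbert_function (i - 1) * hilbert_function (i + 1) \<le> (hilbert_function i)\<^sup>2"
proof -
  let ?h = "\<lambda>i. dim (A i)" and ?e = socle_degree
  obtain B where B: "B \<subseteq> A 1" "A 1 \<subseteq> span B" "card B = 3"
    using basis_exists[of "A 1"] three unfolding hilbert_function_def by metis
  obtain x y z where xyz: "B = {x, y, z}" using B(3) by (auto simp: card_3_iff)
  have gen: "span {x, y, z} = A 1"
    using B xyz span_minimal[OF _ subspace_component] by blast
  note fin = component_finite[OF gen]
  have sym: "?h i = ?h k" if "i + k = ?e" for i k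
    using dim_mult_image_symmetric[OF one_component _ fin, of i k] that by simp
  have le: "2 * ?h n \<le> (n + 1) * (n + 2)" for n
    using dim_component_le[OF gen, of n] card_triangle[of n] by linarith
  define P where "P = (\<lambda>k. \<exists>l\<in>A 1. \<exists>m\<in>A 1. two_generated l m k)"
  define d where "d = (LEAST k. P k)"
  \<comment> \<open>The component above the socle degree is zero, so the least \<open>d\<close>
    exists.\<close>
  have "P ?e"
    unfolding P_def two_generated_def
    using component_above_socle_degree[of "Suc ?e"] subspace_0[OF subspace_component]
    by (auto intro!: bexI[of _ 0])
  then have "P d" unfolding d_def by (rule LeastI)
  then obtain l m where lm: "l \<in> A 1" "m \<in> A 1" "two_generated l m d" unfolding P_def by blast
  \<comment> \<open>For \<open>n = k + 1 \<le> d\<close>, minimality of \<open>d\<close> excludes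
    two linear forms generating degree \<open>n\<close>, so the dimension is maximal there.\<close>
  have exact: "2 * ?h n = (n + 1) * (n + 2)" if "n \<le> d" for n
  proof (cases n)
    case 0
    have "A 0 = span {1}" using component_0 by (simp add: span_singleton)
    then have "?h 0 = 1" using one_neq_zero dim_eq_card_independent[of "{1}"] by (simp add: dim_span)
    then show ?thesis using 0 by simp
  next
    case (Suc k)
    then have "\<not> P k" using that not_less_Least[of k P] unfolding d_def by simp
    then have "?h n = card (SIGMA p:{..n}. {..n-p})"
      using two_generated_or_dim_maximal[OF gen inf, of k] Suc unfolding P_def by blast
    then show ?thesis using card_triangle[of n] by simp
  qed
  have small: "?h (n - 1) * ?h (n + 1) \<le> (?h n)\<^sup>2" if "1 \<le> n" "n \<le> d" for n
  proof (rule triangular_log_concave)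
    show "2 * ?h (n - 1) = n * (n + 1)" using exact[of "n - 1"] that by simp
    show "2 * ?h n = (n + 1) * (n + 2)" using exact that by simp
    \<comment> \<open>Only the upper bound is available here, since \<open>n + 1\<close> may be
      \<open>d + 1\<close>.\<close>
    show "2 * ?h (n + 1) \<le> (n + 2) * (n + 3)"
      using le[of "n + 1"] by (simp add: algebra_simps)
  qed
  let ?r = "\<lambda>i. dim ((*) l ` A i)"
  have step: "?h (Suc (Suc k)) + ?r k \<le> ?h (Suc k) + ?r (Suc k)" if "d \<le> Suc k" for k
    by (rule hilbert_function_step[OF two_generated_mono[OF gen that lm(3)] lm(1,2) fin])
  obtain k where k: "i = Suc k" using i by (cases i) auto
  \<comment> \<open>\<open>Suc q\<close> is the mirror degree \<open>e - i\<close>.\<close>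
  have "\<exists>q. ?e = i + Suc q" using i by (intro exI[of _ "?e - i - 1"]) simp
  then obtain q where q: "?e = i + Suc q" by blast
  have symi: "?h (Suc q) = ?h i" "?h q = ?h (i + 1)" "?h (Suc (Suc q)) = ?h (i - 1)"
    by (rule sym, use q k in simp)+
  have "?h (i - 1) * ?h (i + 1) \<le> (?h i)\<^sup>2"
  proof (cases "i \<le> d \<or> Suc q \<le> d")
    case True
    then show ?thesis
      using small[of i] small[of "Suc q"] i symi by (auto simp: mult.commute)
  next
    case False
    \<comment> \<open>The rank symmetry pairs degrees with sum \<open>e - 1\<close>, so the ranks
      cancel when the step inequalities for \<open>i\<close> and \<open>e - i\<close> are
      added.\<close>
    have "?r q = ?r i" "?r (Suc q) = ?r k"
      by (rule dim_mult_image_symmetric[OF lm(1) _ fin], use q k in simp)+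
    moreover have "?h (i + 1) + ?r k \<le> ?h i + ?r i" using step[of k] False k by simp
    moreover have "?h (Suc (Suc q)) + ?r q \<le> ?h (Suc q) + ?r (Suc q)" using step[of q] False by simp
    ultimately have "?h (i - 1) + ?h (i + 1) \<le> 2 * ?h i" using symi by linarith
    then show ?thesis by (rule le_square_of_add_le)
  qed
  then show ?thesis unfolding hilbert_function_def .
qed

end

theorem theorem2p1:
  fixes scale :: "'k::field \<Rightarrow> 'a::comm_ring_1 \<Rightarrow> 'a"
    and A :: "nat \<Rightarrow> 'a set"
    and j :: nat
    and h :: "nat \<Rightarrow> nat"
  assumes "infinite (UNIV :: 'k set)"
    and "artinian_gorenstein_algebra scale A"
    and "j = graded_algebra.socle_degree scale A"
    and "h = graded_algebra.hilbert_function scale A"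
    and "h 1 = 3"
  shows "\<forall>i. 1 \<le> i \<and> i \<le> j - 1 \<longrightarrow> h (i - 1) * h (i + 1) \<le> (h i)\<^sup>2"
proof -
  interpret artinian_gorenstein_algebra scale A by (rule assms(2))
  show ?thesis
    using hilbert_function_log_concave assms(1,5) unfolding assms(3,4) by blast
qed

end
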